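(* Let $n\ge2$ and $m,l\ge2$ be integers, $\Lambda=(\mathcal A^{(1)},\ldots,\mathcal A^{(m-1)})\in\mathcal F_{m,n}$, $\Theta=(\mathcal B^{(1)},\ldots,\mathcal B^{(l-1)})\in\mathcal F_{l,n}$ and $\boldsymbol a,\boldsymbol b\in\mathbb R^n$. Put $F(\boldsymbol x):=\sum_{k=1}^{m-1}\mathcal A^{(k)}\boldsymbol x^{m-k}+\boldsymbol a$, $G(\boldsymbol x):=\sum_{p=1}^{l-1}\mathcal B^{(p)}\boldsymbol x^{l-p}+\boldsymbol b$, and let $\Omega$ be the solution set of $\mathrm{GPCP}(\Lambda,\boldsymbol a,\Theta,\boldsymbol b)$. Suppose that $\Omega$ is nonempty and that the following two conditions hold. (1) Whenever a sequence $\{\boldsymbol x^{(i)}\}\subset\mathbb R^n$ satisfies $\|\boldsymbol x^{(i)}\|\to\infty$ and $$\frac{[-F(\boldsymbol x^{(i)})]_+}{\|\boldsymbol x^{(i)}\|}\to\boldsymbol 0,\qquad\frac{[-G(\boldsymbol x^{(i)})]_+}{\|\boldsymbol x^{(i)}\|}\to\boldsymbol 0\qquad\text{as }i\to\infty,$$ there exists an index $j_0\in\{1,\ldots,n\}$ such that $$\limsup_{i\to\infty}\frac{\min\{F_{j_0}(\boldsymbol x^{(i)}),G_{j_0}(\boldsymbol x^{(i)})\}}{\|\boldsymbol x^{(i)}\|}>0.$$ (2) For any sequence $\{\boldsymbol x^{(i)}\}$ in $\mathbb R^n$ with $\boldsymbol x^{(i)}\to\bar{\boldsymbol x}\in\Omega$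 as $i\to\infty$ and $\boldsymbol x^{(i)}\neq\bar{\boldsymbol x}$, there exist a subsequence $\{\boldsymbol x^{(i_j)}\}$ of $\{\boldsymbol x^{(i)}\}$ and an index $j_0\in\{1,\ldots,n\}$ such that $$\lim_{i_j\to\infty}\frac{\min\{F_{j_0}(\boldsymbol x^{(i_j)}),G_{j_0}(\boldsymbol x^{(i_j)})\}}{\|\boldsymbol x^{(i_j)}-\bar{\boldsymbol x}\|}\neq0.$$ Then $r(\boldsymbol x):=\|\min\{F(\boldsymbol x),G(\boldsymbol x)\}\|$ is a global Lipschitzian error bound for $\mathrm{GPCP}(\Lambda,\boldsymbol a,\Theta,\boldsymbol b)$, i.e. there exists a constant $c>0$ such that $\mathrm{dist}(\boldsymbol x,\Omega)\le c\,r(\boldsymbol x)$ for all $\boldsymbol x\in\mathbb R^n$.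
   Context: $\mathbb T_{m,n}$ is the space of real $m$-th order $n$-dimensional square tensors $\mathcal A=(a_{j_1\ldots j_m})$, $1\le j_1,\ldots,j_m\le n$, and $\mathcal F_{m,n}:=\mathbb T_{m,n}\times\mathbb T_{m-1,n}\times\cdots\times\mathbb T_{2,n}$, so $\mathcal A^{(k)}\in\mathbb T_{m-k+1,n}$, $\mathcal B^{(p)}\in\mathbb T_{l-p+1,n}$. For $\mathcal A\in\mathbb T_{m,n}$ and $\boldsymbol x\in\mathbb R^n$, $\mathcal A\boldsymbol x^{m-1}\in\mathbb R^n$ has $j$-th component $\sum_{j_2,\ldots,j_m=1}^n a_{jj_2\ldots j_m}x_{j_2}\cdots x_{j_m}$. $\mathrm{GPCP}(\Lambda,\boldsymbol a,\Theta,\boldsymbol b)$ is the problem of finding $\boldsymbol x\in\mathbb R^n$ with $F(\boldsymbol x)\in\mathbb R^n_+$, $G(\boldsymbol x)\in\mathbb R^n_+$ and $\langle F(\boldsymbol x),G(\boldsymbol x)\rangle=0$; $\Omega$ is the set of all such $\boldsymbol x$. $F_j$ denotes the $j$-th component of $F$; $\min\{F(\boldsymbol x),G(\boldsymbol x)\}$ is the componentwise minimum; $\boldsymbol z_+$ is the vector with components $\max\{z_i,0\}$; $\|\cdot\|$ is the Euclidean norm; $\mathrm{dist}(\boldsymbol x,\Omega)$ is the Euclidean distance from $\boldsymbol x$ to $\Omega$. In condition (2), "$\lim\neq0$" means that the quotient does not converge to $0$ along the subsequence. *)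

theory Defs
  imports "HOL-Analysis.Analysis"
begin

text \<open>The index set \<open>{1, \<dots>, n}\<close> is the finite type \<open>'n\<close>.  A tensor of order \<open>m\<close> is a function on
  multi-indices, i.e. on lists of length \<open>m\<close>; it is extensional (\<open>undefined\<close> on lists of any other
  length), so that equality of functions is equality of tensors.\<close>

definition tensors :: "nat \<Rightarrow> ('n::finite list \<Rightarrow> real) set" where
  "tensors m = {js. length js = m} \<rightarrow>\<^sub>E UNIV"

text \<open>\<open>tensor_apply A d x\<close> is the vector \<open>A x\<^sup>d\<close>, for \<open>A\<close> of order \<open>d + 1\<close>; the first index of \<open>A\<close>
  is the free one.\<close>

definition tensor_apply :: "('n::finite list \<Rightarrow> real) \<Rightarrow> nat \<Rightarrow> real ^ 'n \<Rightarrow> real ^ 'n" where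
  "tensor_apply A d x = (\<chi> j. \<Sum>js | length js = d. A (j # js) * (\<Prod>i\<leftarrow>js. x $ i))"

definition tensor_families :: "nat \<Rightarrow> (nat \<Rightarrow> 'n::finite list \<Rightarrow> real) set" where
  "tensor_families m = (\<Pi>\<^sub>E k\<in>{1..m - 1}. tensors (m - k + 1))"

definition tensor_poly ::
    "nat \<Rightarrow> (nat \<Rightarrow> 'n::finite list \<Rightarrow> real) \<Rightarrow> real ^ 'n \<Rightarrow> real ^ 'n \<Rightarrow> real ^ 'n" where
  "tensor_poly m \<Lambda> a x = (\<Sum>k = 1..m - 1. tensor_apply (\<Lambda> k) (m - k) x) + a"

definition GPCP_solutions ::
    "nat \<Rightarrow> (nat \<Rightarrow> 'n::finite list \<Rightarrow> real) \<Rightarrow> real ^ 'n \<Rightarrow>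
     nat \<Rightarrow> (nat \<Rightarrow> 'n list \<Rightarrow> real) \<Rightarrow> real ^ 'n \<Rightarrow> (real ^ 'n) set" where
  "GPCP_solutions m \<Lambda> a l \<Theta> b =
    {x. (\<forall>j. 0 \<le> tensor_poly m \<Lambda> a x $ j) \<and> (\<forall>j. 0 \<le> tensor_poly l \<Theta> b x $ j) \<and>
        tensor_poly m \<Lambda> a x \<bullet> tensor_poly l \<Theta> b x = 0}"

definition vec_min :: "real ^ 'n \<Rightarrow> real ^ 'n \<Rightarrow> real ^ 'n::finite" where
  "vec_min u v = (\<chi> j. min (u $ j) (v $ j))"

definition vec_pos_part :: "real ^ 'n \<Rightarrow> real ^ 'n::finite" where
  "vec_pos_part z = (\<chi> j. max (z $ j) 0)"

text \<open>To be used with \<open>\<Omega> \<noteq> {}\<close> only, since \<open>infdist x {} = 0\<close>.\<close>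

definition global_Lipschitzian_error_bound ::
    "('a::metric_space \<Rightarrow> real) \<Rightarrow> 'a set \<Rightarrow> bool" where
  "global_Lipschitzian_error_bound r \<Omega> \<longleftrightarrow> (\<exists>c>0. \<forall>x. infdist x \<Omega> \<le> c * r x)"

end

theory Submission
  imports Defs
begin

text \<open>If no constant works, there are points \<open>x\<^sub>i\<close> with \<open>dist (x\<^sub>i, \<Omega>) > (i + 1) r (x\<^sub>i)\<close>.  If they can be
  chosen with norms tending to infinity, then \<open>r (x\<^sub>i) / \<parallel>x\<^sub>i\<parallel> \<rightarrow> 0\<close> because \<open>dist (x\<^sub>i, \<Omega>) \<le> \<parallel>x\<^sub>i\<parallel> + const\<close>,
  which contradicts condition (1).  Otherwise they are bounded, a subsequence converges to a zero of
  \<open>r\<close>, i.e. to a point \<open>w\<close> of \<open>\<Omega>\<close>, and \<open>r (x\<^sub>i) / \<parallel>x\<^sub>i - w\<parallel> \<rightarrow> 0\<close> contradicts condition (2).\<close>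

lemma continuous_on_tensor_apply:
  fixes S :: "(real ^ 'n::finite) set"
  shows "continuous_on S (tensor_apply A d)"
proof -
  have "continuous_on S (\<lambda>x. \<Prod>i\<leftarrow>js. x $ i)" for js
    by (induction js) (auto intro!: continuous_intros)
  then show ?thesis
    unfolding tensor_apply_def
    by (intro continuous_on_vec_lambda continuous_on_sum continuous_on_mult continuous_on_const) auto
qed

lemma continuous_on_tensor_poly: "continuous_on S (tensor_poly m \<Lambda> a)"
  unfolding tensor_poly_def [abs_def]
  by (intro continuous_on_add continuous_on_sum continuous_on_const continuous_on_tensor_apply)

lemma continuous_on_vec_min:
  assumes "continuous_on S f" and "continuous_on S g"
  shows "continuous_on S (\<lambda>x. vec_min (f x) (g x))"
  unfolding vec_min_def
  by (intro continuous_on_vec_lambda continuous_on_min continuous_on_component assms)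

text \<open>For nonnegative vectors the inner product is a sum of nonnegative terms, so it vanishes
  only if every product \<open>u $ j * v $ j\<close> does. Complementarity thus becomes a
  componentwise condition, and \<open>\<Omega>\<close> is the zero set of the residual.\<close>

lemma vec_min_eq_0_iff:
  "vec_min u v = 0 \<longleftrightarrow> (\<forall>j. 0 \<le> u $ j) \<and> (\<forall>j. 0 \<le> v $ j) \<and> u \<bullet> v = 0"
proof -
  have "u \<bullet> v = 0 \<longleftrightarrow> (\<forall>j. u $ j * v $ j = 0)"
    if "\<And>j. 0 \<le> u $ j" and "\<And>j. 0 \<le> v $ j"
    unfolding inner_vec_def using that by (simp add: sum_nonneg_eq_0_iff)
  moreover have "min s t = 0 \<longleftrightarrow> 0 \<le> s \<and> 0 \<le> t \<and> s * t = 0" for s t :: real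
    by (auto simp: min_def)
  ultimately show ?thesis
    unfolding vec_min_def vec_eq_iff by auto
qed

lemma mem_GPCP_solutions_iff:
  "x \<in> GPCP_solutions m \<Lambda> a l \<Theta> b \<longleftrightarrow> vec_min (tensor_poly m \<Lambda> a x) (tensor_poly l \<Theta> b x) = 0"
  by (simp add: GPCP_solutions_def vec_min_eq_0_iff)

lemma vec_min_commute: "vec_min u v = vec_min v u"
  by (simp add: vec_min_def min.commute)

text \<open>Where \<open>u $ j\<close> is negative, the minimum is at most \<open>u $ j\<close>,
  hence at least as large in absolute value; elsewhere the left component is 0. A small residual
  therefore yields the premises of condition (1).\<close>

lemma norm_vec_pos_part_uminus_le: "norm (vec_pos_part (- u)) \<le> norm (vec_min u v)"
  by (rule norm_le_componentwise_cart) (auto simp: vec_pos_part_def vec_min_def)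

lemma abs_min_component_le: "\<bar>min (u $ j) (v $ j)\<bar> \<le> norm (vec_min u v)"
  using component_le_norm_cart [of "vec_min u v" j] by (simp add: vec_min_def)

theorem theorem5p4:
  fixes m l :: nat
    and \<Lambda> \<Theta> :: "nat \<Rightarrow> 'n::finite list \<Rightarrow> real"
    and a b :: "real ^ 'n"
    and F G :: "real ^ 'n \<Rightarrow> real ^ 'n"
    and \<Omega> :: "(real ^ 'n) set"
  assumes "CARD('n) \<ge> 2" and "m \<ge> 2" and "l \<ge> 2"
    and "\<Lambda> \<in> tensor_families m" and "\<Theta> \<in> tensor_families l"
    and F: "F = tensor_poly m \<Lambda> a"
    and G: "G = tensor_poly l \<Theta> b"
    and \<Omega>: "\<Omega> = GPCP_solutions m \<Lambda> a l \<Theta> b"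
    and "\<Omega> \<noteq> {}"
    and cond1: "\<And>x :: nat \<Rightarrow> real ^ 'n.
      filterlim (\<lambda>i. norm (x i)) at_top sequentially \<Longrightarrow>
      (\<lambda>i. vec_pos_part (- F (x i)) /\<^sub>R norm (x i)) \<longlonglongrightarrow> 0 \<Longrightarrow>
      (\<lambda>i. vec_pos_part (- G (x i)) /\<^sub>R norm (x i)) \<longlonglongrightarrow> 0 \<Longrightarrow>
      \<exists>j0. limsup (\<lambda>i. ereal (min (F (x i) $ j0) (G (x i) $ j0) / norm (x i))) > 0"
    and cond2: "\<And>(x :: nat \<Rightarrow> real ^ 'n) xbar.
      xbar \<in> \<Omega> \<Longrightarrow> x \<longlonglongrightarrow> xbar \<Longrightarrow> (\<forall>i. x i \<noteq> xbar) \<Longrightarrow>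
      \<exists>(s :: nat \<Rightarrow> nat) j0. strict_mono s \<and>
        \<not> (\<lambda>i. min (F (x (s i)) $ j0) (G (x (s i)) $ j0) / norm (x (s i) - xbar)) \<longlonglongrightarrow> 0"
  shows "global_Lipschitzian_error_bound (\<lambda>x. norm (vec_min (F x) (G x))) \<Omega>"
proof (rule ccontr)
  define r where "r x = norm (vec_min (F x) (G x))" for x
  assume "\<not> ?thesis"
  then have bad: "\<exists>x. c * r x < infdist x \<Omega>" if "c > 0" for c
    using that by (auto simp: global_Lipschitzian_error_bound_def r_def not_le)
  have r_nonneg: "r x \<ge> 0" for x
    by (simp add: r_def)
  have cont: "continuous_on UNIV r"
    unfolding r_def [abs_def] F G
    by (intro continuous_on_norm continuous_on_vec_min continuous_on_tensor_poly)
  have mem_iff: "x \<in> \<Omega> \<longleftrightarrow> r x = 0" for x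
    by (simp add: r_def F G \<Omega> mem_GPCP_solutions_iff)
  have comp_le: "\<bar>min (F x $ j) (G x $ j)\<bar> \<le> r x" for x j
    by (simp add: r_def abs_min_component_le)
  have pos_le: "norm (vec_pos_part (- F x)) \<le> r x" "norm (vec_pos_part (- G x)) \<le> r x" for x
    using norm_vec_pos_part_uminus_le vec_min_commute unfolding r_def by metis+
  show False
  \<comment> \<open>One index \<open>i\<close> controls both the norm and the constant, so the
    negation gives a single \<open>N\<close> for which all points violating the bound with constant
    \<open>N + 1\<close> lie in the ball of radius \<open>N\<close>.\<close>
  proof (cases "\<forall>i :: nat. \<exists>x. real i \<le> norm x \<and> real (Suc i) * r x < infdist x \<Omega>")
    case True
    then obtain x where x: "\<And>i. real i \<le> norm (x i)"
        "\<And>i. real (Suc i) * r (x i) < infdist (x i) \<Omega>"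
      by metis
    obtain w where w: "w \<in> \<Omega>"
      using \<open>\<Omega> \<noteq> {}\<close> by blast
    have lim: "filterlim (\<lambda>i. norm (x i)) at_top sequentially"
      by (rule filterlim_at_top_mono [OF filterlim_real_sequentially]) (simp add: x)
    have quot: "(\<lambda>i. r (x i) / norm (x i)) \<longlonglongrightarrow> 0"
    proof (rule Lim_null_comparison)
      show "\<forall>\<^sub>F i in sequentially. norm (r (x i) / norm (x i)) \<le> (1 + norm w) * inverse (real (Suc i))"
        \<comment> \<open>From \<open>i = 1\<close> on, \<open>norm (x i) \<ge> 1\<close>, so
          \<open>norm w\<close> can be absorbed into \<open>norm w * norm (x i)\<close> and the
          division is legitimate.\<close>
        using eventually_ge_at_top [of 1]
      proof eventually_elim
        case (elim i)
        with x(1) [of i] have "norm (x i) \<ge> 1"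
          by linarith
        have "real (Suc i) * r (x i) \<le> norm (x i) + norm w"
          using x(2) [of i] infdist_le [OF w, of "x i"] norm_triangle_ineq4 [of "x i" w]
          by (simp add: dist_norm)
        also have "\<dots> \<le> (1 + norm w) * norm (x i)"
          using mult_left_mono [OF \<open>norm (x i) \<ge> 1\<close>, of "norm w"] by (simp add: algebra_simps)
        finally have "r (x i) \<le> (1 + norm w) * inverse (real (Suc i)) * norm (x i)"
          by (simp add: field_simps)
        with \<open>norm (x i) \<ge> 1\<close> have "r (x i) / norm (x i) \<le> (1 + norm w) * inverse (real (Suc i))"
          by (subst pos_divide_le_eq) linarith+
        then show ?case
          by (simp add: r_nonneg)
      qed
      show "(\<lambda>i. (1 + norm w) * inverse (real (Suc i))) \<longlonglongrightarrow> 0"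
        by (intro tendsto_mult_right_zero LIMSEQ_inverse_real_of_nat)
    qed
    \<comment> \<open>\<open>H\<close> stands for \<open>F\<close> and for \<open>G\<close>.\<close>
    have pos_lim: "(\<lambda>i. vec_pos_part (- H (x i)) /\<^sub>R norm (x i)) \<longlonglongrightarrow> 0"
      if "\<And>x. norm (vec_pos_part (- H x)) \<le> r x" for H
      by (rule Lim_null_comparison [OF _ quot])
        (auto simp: divide_inverse_commute intro!: always_eventually mult_left_mono that)
    obtain j where j: "limsup (\<lambda>i. ereal (min (F (x i) $ j) (G (x i) $ j) / norm (x i))) > 0"
      using cond1 [OF lim pos_lim [OF pos_le(1)] pos_lim [OF pos_le(2)]] by blast
    have "(\<lambda>i. min (F (x i) $ j) (G (x i) $ j) / norm (x i)) \<longlonglongrightarrow> 0"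
      by (rule Lim_null_comparison [OF _ quot])
        (auto intro!: always_eventually divide_right_mono comp_le)
    then have "(\<lambda>i. ereal (min (F (x i) $ j) (G (x i) $ j) / norm (x i))) \<longlonglongrightarrow> ereal 0"
      by (intro tendsto_ereal)
    then have "limsup (\<lambda>i. ereal (min (F (x i) $ j) (G (x i) $ j) / norm (x i))) = ereal 0"
      by (intro lim_imp_Limsup) auto
    with j show False
      by (simp add: zero_ereal_def)
  next
    case False
    then obtain N where N: "\<And>x. real (Suc N) * r x < infdist x \<Omega> \<Longrightarrow> norm x < real N"
      by (auto simp: not_le)
    \<comment> \<open>The shift by \<open>N\<close> keeps every constant at least
      \<open>N + 1\<close>, so that all the chosen points stay in the ball.\<close>
    have "\<forall>i :: nat. \<exists>x. real (Suc (N + i)) * r x < infdist x \<Omega>"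
      using bad by simp
    then obtain y where y: "\<And>i. real (Suc (N + i)) * r (y i) < infdist (y i) \<Omega>"
      by metis
    have y_bound: "norm (y i) \<le> real N" for i
    proof -
      have "real (Suc N) * r (y i) \<le> real (Suc (N + i)) * r (y i)"
        by (intro mult_right_mono r_nonneg) simp
      with y [of i] N [of "y i"] show ?thesis
        by simp
    qed
    \<comment> \<open>The solution \<open>w\<close> is left free: an arbitrary one shows that
      \<open>r\<close> tends to 0 along the sequence, and later the limit point itself gives the
      bound relative to \<open>norm (y k - z)\<close>.\<close>
    have r_le: "r (y i) \<le> dist w (y i) * inverse (real (Suc i))" if "w \<in> \<Omega>" for w i
    proof -
      have "real (Suc i) * r (y i) \<le> real (Suc (N + i)) * r (y i)"
        by (intro mult_right_mono r_nonneg) simp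
      also have "\<dots> \<le> dist w (y i)"
        using y [of i] infdist_le [OF that, of "y i"] by (simp add: dist_commute)
      finally show ?thesis
        by (simp add: field_simps)
    qed
    \<comment> \<open>On \<open>\<Omega>\<close> both sides of the strict inequality for
      \<open>y i\<close> would be 0.\<close>
    have y_notin: "y i \<notin> \<Omega>" for i
      using y [of i] mem_iff [of "y i"] by auto
    have inv_lim: "(\<lambda>i. c * inverse (real (Suc (s i)))) \<longlonglongrightarrow> 0" if "strict_mono s" for c s
      using LIMSEQ_subseq_LIMSEQ [OF LIMSEQ_inverse_real_of_nat that]
      by (intro tendsto_mult_right_zero) (simp add: o_def)
    have "compact (cball (0 :: real ^ 'n) (real N))"
      by simp
    then obtain z s where s: "strict_mono s" and ys: "(y \<circ> s) \<longlonglongrightarrow> z"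
      unfolding compact_def using y_bound by (metis mem_cball_0)
    have "(\<lambda>i. r ((y \<circ> s) i)) \<longlonglongrightarrow> r z"
      by (rule continuous_on_tendsto_compose [OF cont ys]) auto
    moreover have "(\<lambda>i. r ((y \<circ> s) i)) \<longlonglongrightarrow> 0"
    proof -
      obtain w where w: "w \<in> \<Omega>"
        using \<open>\<Omega> \<noteq> {}\<close> by blast
      have "r (y (s i)) \<le> (norm w + real N) * inverse (real (Suc (s i)))" for i
      proof -
        have "dist w (y (s i)) \<le> norm w + real N"
          using norm_triangle_ineq4 [of w "y (s i)"] y_bound [of "s i"] by (simp add: dist_norm)
        then show ?thesis
          by (intro order_trans [OF r_le [OF w]] mult_right_mono) auto
      qed
      then show ?thesis
        by (intro Lim_null_comparison [OF _ inv_lim [OF s]] always_eventually) (auto simp: r_nonneg)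
    qed
    ultimately have z: "z \<in> \<Omega>"
      using LIMSEQ_unique mem_iff by blast
    have "\<forall>i. (y \<circ> s) i \<noteq> z"
      using y_notin z by auto
    with cond2 [OF z ys] obtain t j where t: "strict_mono t" and
      nlim: "\<not> (\<lambda>i. min (F ((y \<circ> s) (t i)) $ j) (G ((y \<circ> s) (t i)) $ j) /
        norm ((y \<circ> s) (t i) - z)) \<longlonglongrightarrow> 0"
      by blast
    have st: "strict_mono (s \<circ> t)"
      using s t by (rule strict_mono_o)
    \<comment> \<open>Since \<open>z\<close> is a solution, \<open>r_le\<close> applies with
      \<open>w = z\<close> and the distance cancels. The bound holds for every \<open>k\<close>,
      hence along whichever subsequence condition (2) selects.\<close>
    have "\<bar>min (F (y k) $ j) (G (y k) $ j)\<bar> / norm (y k - z) \<le> inverse (real (Suc k))" for k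
    proof -
      have "y k \<noteq> z"
        using y_notin z by auto
      moreover have "\<bar>min (F (y k) $ j) (G (y k) $ j)\<bar> \<le> norm (y k - z) * inverse (real (Suc k))"
        using order_trans [OF comp_le r_le [OF z]] by (simp add: dist_norm norm_minus_commute)
      ultimately show ?thesis
        by (simp add: pos_divide_le_eq mult.commute)
    qed
    then have "(\<lambda>i. min (F ((y \<circ> s) (t i)) $ j) (G ((y \<circ> s) (t i)) $ j) /
        norm ((y \<circ> s) (t i) - z)) \<longlonglongrightarrow> 0"
      by (intro Lim_null_comparison [OF _ inv_lim [OF st, of 1]] always_eventually) auto
    with nlim show False
      by blast
  qed
qed

end
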